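(* Let $\Bbbk$ be an algebraically closed field and, for $n\geq 1$, let $\mathcal{S}=\Bbbk[x_1,\ldots,x_n]$ be the standard graded polynomial ring with degree-$d$ part $\mathcal{S}_d$. Then: (1) for every $n\geq 1$, all $x,y,u,v\in\mathcal{S}_1$ and all $f,g,p,q\in\mathcal{S}_2$, the quartic form $$x^2f+y^2g+u^2p+v^2q\in\mathcal{S}_4$$ is a limit of forms in $\mathcal{S}_4$ of strength $\leq 3$; (2) there exists an integer $N$ such that for every $n\geq N$ there exist $x,y,u,v\in\mathcal{S}_1$ and $f,g,p,q\in\mathcal{S}_2$ for which the form $x^2f+y^2g+u^2p+v^2q$ has strength exactly $4$.
   Context: A strength decomposition of a homogeneous polynomial (form) $f\in\mathcal{S}$ is an expression $f=g_1h_1+\ldots+g_rh_r$ where all $g_i,h_i\in\mathcal{S}$ are homogeneous with $1\leq\deg(g_i),\deg(h_i)\leq\deg(f)-1$; its length is $r$. The strength of $f$ is the smallest length of a strength decomposition of $f$ (the zero form has strength $0$, via the empty sum). A form $h\in\mathcal{S}_4$ is called a limit of forms of strength $\leq 3$ if there is a family $h(t)$, depending polynomially on $t$ (i.e. an element of $\mathcal{S}_4\otimes_{\Bbbk}\Bbbk[t]$), such that $h(0)=h$ and $h(t)\in\mathcal{S}_4$ has strength $\leq 3$ for every $t\in\Bbbk\setminus\{0\}$. In particular such an $h$ lies in the Zariski closure of the set of forms in $\mathcal{S}_4$ of strength $\leq 3$. *)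

theory Defs
  imports
    "HOL-Library.Poly_Mapping"
    "HOL-Computational_Algebra.Polynomial"
    "HOL-Library.Extended_Nat"
begin

text \<open>
  A multivariate polynomial is a finitely supported map from monomials to coefficients; a monomial
  is a finitely supported exponent vector over the variables, which are indexed by \<open>nat\<close>. The
  ring operations are those of \<^theory>\<open>HOL-Library.Poly_Mapping\<close>. The ring in
  \<open>n\<close> variables is the subring of polynomials that only use the variables with index
  \<open>0, \<dots>, n - 1\<close>, so that \<open>n\<close> can be quantified over.
\<close>

type_synonym 'k mpoly = "(nat \<Rightarrow>\<^sub>0 nat) \<Rightarrow>\<^sub>0 'k"

definition monom_deg :: "(nat \<Rightarrow>\<^sub>0 nat) \<Rightarrow> nat" where
  "monom_deg m = (\<Sum>i\<in>Poly_Mapping.keys m. Poly_Mapping.lookup m i)"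

definition forms :: "nat \<Rightarrow> nat \<Rightarrow> 'k::zero mpoly set" where
  "forms n d = {f. \<forall>m\<in>Poly_Mapping.keys f. Poly_Mapping.keys m \<subseteq> {..<n} \<and> monom_deg m = d}"

text \<open>The total degree; the zero polynomial gets degree 0.\<close>

definition total_deg :: "'k::zero mpoly \<Rightarrow> nat" where
  "total_deg f = Max (insert 0 (monom_deg ` Poly_Mapping.keys f))"

definition homogeneous :: "nat \<Rightarrow> 'k::zero mpoly \<Rightarrow> bool" where
  "homogeneous n f \<longleftrightarrow> (\<exists>d. f \<in> forms n d)"

text \<open>
  The degree bounds exclude zero factors, since \<open>total_deg 0 = 0\<close>. This does not affect the minimal
  length, because zero summands can be dropped.
\<close>

definition strength_decomposition ::
    "nat \<Rightarrow> 'k::comm_ring_1 mpoly \<Rightarrow> ('k mpoly \<times> 'k mpoly) list \<Rightarrow> bool" where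
  "strength_decomposition n f ps \<longleftrightarrow>
     (\<forall>(g, h)\<in>set ps. homogeneous n g \<and> homogeneous n h \<and>
        1 \<le> total_deg g \<and> total_deg g \<le> total_deg f - 1 \<and>
        1 \<le> total_deg h \<and> total_deg h \<le> total_deg f - 1) \<and>
     f = (\<Sum>(g, h)\<leftarrow>ps. g * h)"

text \<open>
  The infimum of the empty set is \<open>\<infinity>\<close>; this value occurs only for forms without any strength
  decomposition, namely nonzero forms of degree at most 1.
\<close>

definition strength :: "nat \<Rightarrow> 'k::comm_ring_1 mpoly \<Rightarrow> enat" where
  "strength n f = Inf {enat (length ps) | ps. strength_decomposition n f ps}"

text \<open>
  A polynomial family of forms, that is, an element of the tensor product of \<open>forms n d\<close> with the
  univariate polynomial ring over \<open>'k\<close>, is a univariate polynomial \<open>H\<close> in the parameter with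
  coefficients in \<open>forms n d\<close>. Its member at \<open>t :: 'k\<close> is the evaluation of \<open>H\<close> at the
  constant polynomial \<open>t\<close>.
\<close>

definition const :: "'k::zero \<Rightarrow> 'k mpoly" where
  "const c = Poly_Mapping.single 0 c"

definition limit_of_strength_le :: "nat \<Rightarrow> nat \<Rightarrow> nat \<Rightarrow> 'k::field mpoly \<Rightarrow> bool" where
  "limit_of_strength_le n d r h \<longleftrightarrow>
     (\<exists>H :: 'k mpoly poly. (\<forall>i. coeff H i \<in> forms n d) \<and> poly H (const 0) = h \<and>
        (\<forall>t. t \<noteq> 0 \<longrightarrow> strength n (poly H (const t)) \<le> enat r))"

end

theory Submission
  imports Defs
begin

text \<open>
  With \<open>h = x\<^sup>2 f + y\<^sup>2 g + u\<^sup>2 p + v\<^sup>2 q\<close>, the first part rests on the identity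
  \<open>(x\<^sup>2 + t g) (y\<^sup>2 + t f) - (u\<^sup>2 - t q) (v\<^sup>2 - t p) - (x y - u v) (x y + u v) = t (h + t (f g - p q))\<close>,
  whose left hand side is a sum of three products of quadrics (\<open>limit_of_strength_le_3\<close>).

  For the lower bound, take \<open>h = \<Sum> x\<^sub>i\<^sup>2 f\<^sub>i\<close> with \<open>f\<^sub>i = \<Sum> y\<^sub>k z\<^bsub>k,i\<^esub>\<close>, where \<open>i < 4\<close> and \<open>k < M\<close>. Suppose that \<open>h\<close> is
  a sum of at most three products. Only the products of degree four matter, and each of them
  either has a linear factor or is a product of two quadrics. If \<open>M\<close> is large, there is a point
  \<open>P = (0, y, 0)\<close> with \<open>y \<noteq> 0\<close> at which these linear factors and quadrics all vanish
  (\<open>common_zero\<close>). Expand \<open>h\<close> around \<open>P\<close> in directions \<open>w\<close> in which the linear factors vanish. On the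
  one hand, \<open>h\<close> vanishes to order three at \<open>P\<close>, with leading term \<open>\<Sum> \<xi>\<^sub>i\<^sup>2 \<tau>\<^sub>i\<close>, where \<open>\<xi>\<^sub>i = x\<^sub>i(w)\<close> and
  \<open>\<tau>\<^sub>i = df\<^sub>i(w)\<close> are independent linear forms. On the other hand, a product \<open>a b\<close> of quadrics contributes
  \<open>da(w) db(w)\<close> in order two and \<open>da(w) b(w) + a(w) db(w)\<close> in order three. The order two terms add up
  to zero, so the values of the differentials \<open>da\<close>, \<open>db\<close> form an isotropic subspace of a hyperbolic
  space. Hence they all vanish on a subspace cut out by one equation per product (\<open>isotropic_common_kernel\<close>).
  On that subspace, of codimension at most three, the cubic \<open>\<Sum> \<xi>\<^sub>i\<^sup>2 \<tau>\<^sub>i\<close> vanishes, which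
  \<open>cubic_slice_rank\<close> excludes for four terms. The argument works in every characteristic.

  Linear forms, quadratic forms and linear substitutions are treated as functions on coordinate
  vectors, since they are composed and restricted all the time; \<open>mpoly_eval\<close> translates between these
  functions and polynomials.
\<close>

section \<open>Polynomial functions over an algebraically closed field\<close>

text \<open>
  If the field were finite, adding \<open>1\<close> to the product of all \<open>T - a\<close> would give a polynomial without
  a root. Infinitude lets polynomial identities be read off from values, in every characteristic.
\<close>

lemma infinite_alg_closed: "infinite (UNIV :: 'k::alg_closed_field set)"
proof
  assume fin: "finite (UNIV :: 'k set)"
  define p :: "'k poly" where "p = (\<Prod>a\<in>UNIV. [:- a, 1:]) + 1"
  have "degree (\<Prod>a\<in>(UNIV :: 'k set). [:- a, 1:]) = (\<Sum>a\<in>(UNIV :: 'k set). 1)"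
    by (subst degree_prod_eq_sum_degree) auto
  then have "degree p > 0"
    using fin by (simp add: p_def degree_add_eq_left finite_UNIV_card_ge_0)
  then obtain x where "poly p x = 0"
    using alg_closed_imp_poly_has_root by blast
  moreover have "poly p x = 1"
    using fin by (auto simp: p_def poly_prod)
  ultimately show False by simp
qed

lemma poly_zero_if_vanishing:
  fixes p :: "'k::alg_closed_field poly"
  assumes "\<And>t. poly p t = 0"
  shows "p = 0"
proof (rule ccontr)
  assume "p \<noteq> 0"
  then have "finite {t. poly p t = 0}" by (rule poly_roots_finite)
  then show False using assms infinite_alg_closed[where 'k='k] by simp
qed

lemma binary_quadratic_form_isotropic:
  fixes a b c :: "'k::alg_closed_field"
  shows "\<exists>s t. (s \<noteq> 0 \<or> t \<noteq> 0) \<and> a * s\<^sup>2 + b * s * t + c * t\<^sup>2 = 0"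
proof (cases "a = 0")
  case True
  then show ?thesis by (intro exI[of _ 1] exI[of _ 0]) auto
next
  case False
  then have "degree [:c, b, a:] > 0" by simp
  then obtain x where "poly [:c, b, a:] x = 0"
    using alg_closed_imp_poly_has_root by blast
  then show ?thesis
    by (intro exI[of _ x] exI[of _ 1]) (auto simp: algebra_simps power2_eq_square)
qed

section \<open>Linear functionals and quadratic functions on coordinate space\<close>

definition lincomb :: "'k \<Rightarrow> (nat \<Rightarrow> 'k) \<Rightarrow> 'k \<Rightarrow> (nat \<Rightarrow> 'k) \<Rightarrow> nat \<Rightarrow> 'k::comm_ring_1" where
  "lincomb s v t w = (\<lambda>i. s * v i + t * w i)"

definition unit_vec :: "nat \<Rightarrow> nat \<Rightarrow> 'k::comm_ring_1" where
  "unit_vec i = (\<lambda>j. if j = i then 1 else 0)"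

definition supported :: "nat set \<Rightarrow> (nat \<Rightarrow> 'k::zero) \<Rightarrow> bool" where
  "supported I v \<longleftrightarrow> (\<forall>i. v i \<noteq> 0 \<longrightarrow> i \<in> I)"

definition lin :: "((nat \<Rightarrow> 'k) \<Rightarrow> 'k::comm_ring_1) \<Rightarrow> bool" where
  "lin l \<longleftrightarrow> (\<forall>s v t w. l (lincomb s v t w) = s * l v + t * l w)"

definition linmap :: "((nat \<Rightarrow> 'k) \<Rightarrow> nat \<Rightarrow> 'k::comm_ring_1) \<Rightarrow> bool" where
  "linmap L \<longleftrightarrow> (\<forall>s v t w. L (lincomb s v t w) = lincomb s (L v) t (L w))"

text \<open>
  In characteristic two \<open>q\<close> cannot be recovered from its polar form \<open>B\<close>, so both are kept. The identity contains homogeneity as the case \<open>t = 0\<close>, and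
  \<open>B v w\<close> is the coefficient of \<open>t\<close> in \<open>q (v + t w)\<close>, that is, the differential of \<open>q\<close> at \<open>v\<close>.
\<close>

definition polar :: "((nat \<Rightarrow> 'k) \<Rightarrow> 'k) \<Rightarrow> ((nat \<Rightarrow> 'k) \<Rightarrow> (nat \<Rightarrow> 'k) \<Rightarrow> 'k::comm_ring_1) \<Rightarrow> bool" where
  "polar q B \<longleftrightarrow> (\<forall>v. lin (B v)) \<and>
     (\<forall>s v t w. q (lincomb s v t w) = s\<^sup>2 * q v + s * t * B v w + t\<^sup>2 * q w)"

definition quad :: "((nat \<Rightarrow> 'k) \<Rightarrow> 'k::comm_ring_1) \<Rightarrow> bool" where
  "quad q \<longleftrightarrow> (\<exists>B. polar q B)"

lemma lin_lincomb: "lin l \<Longrightarrow> l (lincomb s v t w) = s * l v + t * l w"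
  by (simp add: lin_def)

lemma lin_zero:
  assumes "lin l" "\<And>i. v i = 0"
  shows "l v = 0"
proof -
  have "v = lincomb 0 v 0 v" using assms(2) by (auto simp: lincomb_def)
  then show ?thesis using lin_lincomb[OF assms(1), of 0 v 0 v] by simp
qed

lemma lin_coordinate: "lin (\<lambda>v. v i)"
  by (simp add: lin_def lincomb_def)

lemma lin_const_mult: "lin l \<Longrightarrow> lin (\<lambda>v. c * l v)"
  by (simp add: lin_def algebra_simps)

lemma lin_sum: "(\<And>i. i \<in> I \<Longrightarrow> lin (l i)) \<Longrightarrow> lin (\<lambda>v. \<Sum>i\<in>I. l i v)"
  by (simp add: lin_def sum.distrib sum_distrib_left)

lemma quad_const_mult: "quad q \<Longrightarrow> quad (\<lambda>v. c * q v)"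
  unfolding quad_def
proof (elim exE)
  fix B assume "polar q B"
  then show "\<exists>B. polar (\<lambda>v. c * q v) B"
    by (intro exI[of _ "\<lambda>v w. c * B v w"]) (simp add: polar_def lin_def algebra_simps)
qed

lemma quad_sum:
  assumes "\<And>i. i \<in> I \<Longrightarrow> quad (q i)"
  shows "quad (\<lambda>v. \<Sum>i\<in>I. q i v)"
proof -
  obtain B where "\<And>i. i \<in> I \<Longrightarrow> polar (q i) (B i)"
    using assms unfolding quad_def by metis
  then have "polar (\<lambda>v. \<Sum>i\<in>I. q i v) (\<lambda>v w. \<Sum>i\<in>I. B i v w)"
    by (simp add: polar_def lin_def sum.distrib sum_distrib_left)
  then show ?thesis by (auto simp: quad_def)
qed

lemma quad_mult:
  assumes "lin l" "lin l'"
  shows "quad (\<lambda>v. l v * l' v)"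
  unfolding quad_def
  by (rule exI[of _ "\<lambda>v w. l v * l' w + l w * l' v"])
     (use assms in \<open>auto simp: polar_def lin_def algebra_simps power2_eq_square\<close>)

lemma lin_comp: "lin l \<Longrightarrow> linmap L \<Longrightarrow> lin (\<lambda>v. l (L v))"
  by (simp add: lin_def linmap_def)

lemma quad_comp:
  assumes "quad q" "linmap L"
  shows "quad (\<lambda>v. q (L v))"
proof -
  obtain B where "polar q B" using assms(1) by (auto simp: quad_def)
  then have "polar (\<lambda>v. q (L v)) (\<lambda>v w. B (L v) (L w))"
    using assms(2) by (auto simp: polar_def linmap_def lin_def)
  then show ?thesis by (auto simp: quad_def)
qed

lemma lin_expand:
  assumes "lin l" "finite S" "supported S v"
  shows "l v = (\<Sum>i\<in>S. v i * l (unit_vec i))"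
  using assms(2,3)
proof (induction S arbitrary: v rule: finite_induct)
  case empty
  then have "v i = 0" for i by (auto simp: supported_def)
  then show ?case by (simp add: lin_zero[OF assms(1)])
next
  case (insert x S)
  define w where "w = (\<lambda>i. if i = x then 0 else v i)"
  have "supported S w" using insert.prems by (auto simp: supported_def w_def)
  then have "l w = (\<Sum>i\<in>S. w i * l (unit_vec i))" by (rule insert.IH)
  also have "\<dots> = (\<Sum>i\<in>S. v i * l (unit_vec i))"
    using insert.hyps by (intro sum.cong) (auto simp: w_def)
  finally have w: "l w = (\<Sum>i\<in>S. v i * l (unit_vec i))" .
  have "v = lincomb (v x) (unit_vec x) 1 w"
    by (auto simp: lincomb_def unit_vec_def w_def)
  then have "l v = v x * l (unit_vec x) + 1 * l w"
    using lin_lincomb[OF assms(1)] by metis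
  then show ?case using w insert.hyps by simp
qed

text \<open>
  The projection along a unit vector onto the hyperplane \<open>l = 0\<close> when \<open>c\<close> is the value of \<open>l\<close> at
  that unit vector. Composing with it eliminates one coordinate and one linear equation at once.
\<close>

lemma linmap_eliminate:
  fixes l :: "(nat \<Rightarrow> 'k) \<Rightarrow> 'k::field"
  assumes "lin l"
  shows "linmap (\<lambda>v. lincomb 1 v (- l v / c) (unit_vec i))"
  unfolding linmap_def lin_lincomb[OF assms]
  by (auto simp: lincomb_def fun_eq_iff algebra_simps add_divide_distrib diff_divide_distrib)

section \<open>Common zeros of quadratic functions in many variables\<close>

text \<open>
  Each additional linear equation costs one coordinate: either it holds for every vector supported
  on \<open>I\<close>, or it can be solved for a coordinate in \<open>I\<close>. The substitution keeps the class of
  quadratic functions, and the new vector agrees with the old one off the eliminated coordinate, so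
  it stays nonzero.
\<close>

lemma common_zero_add_linear:
  fixes M r :: nat
  assumes base: "\<And>I (qs :: ((nat \<Rightarrow> 'k) \<Rightarrow> 'k::field) list).
      finite I \<Longrightarrow> card I \<ge> M \<Longrightarrow> length qs \<le> r \<Longrightarrow> (\<forall>q\<in>set qs. quad q) \<Longrightarrow>
      \<exists>v. supported I v \<and> (\<exists>i. v i \<noteq> 0) \<and> (\<forall>q\<in>set qs. q v = 0)"
  shows "finite I \<Longrightarrow> card I \<ge> M + length ls \<Longrightarrow> length qs \<le> r \<Longrightarrow> (\<forall>q\<in>set qs. quad q) \<Longrightarrow>
      (\<forall>l\<in>set ls. lin l) \<Longrightarrow>
      \<exists>v :: nat \<Rightarrow> 'k. supported I v \<and> (\<exists>i. v i \<noteq> 0) \<and> (\<forall>q\<in>set qs. q v = 0) \<and>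
        (\<forall>l\<in>set ls. l v = 0)"
proof (induction "length ls" arbitrary: ls I qs)
  case 0
  then show ?case using base[of I qs] by auto
next
  case (Suc n)
  then obtain l ls' where ls: "ls = l # ls'" by (cases ls) auto
  have l: "lin l" using Suc.prems ls by auto
  show ?case
  proof (cases "\<forall>i\<in>I. l (unit_vec i) = 0")
    case True
    obtain v where v: "supported I v" "\<exists>i. v i \<noteq> 0" "\<forall>q\<in>set qs. q v = 0" "\<forall>l\<in>set ls'. l v = 0"
      using Suc.hyps(1)[of ls' I qs] Suc.hyps(2) Suc.prems ls by auto
    have "l v = 0"
      using lin_expand[OF l Suc.prems(1) v(1)] True by simp
    then show ?thesis using v ls by auto
  next
    case False
    then obtain i where i: "i \<in> I" "l (unit_vec i) \<noteq> 0" by auto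
    define L where "L = (\<lambda>v. lincomb 1 v (- l v / l (unit_vec i)) (unit_vec i))"
    have L: "linmap L" unfolding L_def by (rule linmap_eliminate[OF l])
    have "\<exists>v. supported (I - {i}) v \<and> (\<exists>i. v i \<noteq> 0) \<and> (\<forall>q\<in>set (map (\<lambda>q v. q (L v)) qs). q v = 0) \<and>
        (\<forall>l\<in>set (map (\<lambda>l v. l (L v)) ls'). l v = 0)"
      using Suc.hyps(2) Suc.prems ls i
      by (intro Suc.hyps(1)) (auto intro: quad_comp[OF _ L] lin_comp[OF _ L])
    then obtain v j where v: "supported (I - {i}) v" "v j \<noteq> 0" "\<forall>q\<in>set qs. q (L v) = 0"
        "\<forall>l\<in>set ls'. l (L v) = 0" by auto
    have "supported I (L v)" using v(1) i(1)
      by (auto simp: supported_def L_def lincomb_def unit_vec_def split: if_splits)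
    moreover have "L v j \<noteq> 0" using v(1,2)
      by (auto simp: supported_def L_def lincomb_def unit_vec_def)
    moreover have "l (L v) = 0" using i(2) by (simp add: L_def lin_lincomb[OF l])
    ultimately show ?thesis using v ls by auto
  qed
qed

text \<open>
  Instead of the projective dimension theorem a doubling argument suffices, because the number of
  variables is at our disposal. Two zeros \<open>u\<close>, \<open>w\<close> of the first \<open>r\<close> functions are taken in disjoint
  blocks of coordinates, the second one also orthogonal to \<open>u\<close> for the polar forms of these \<open>r\<close>
  functions. Then the first \<open>r\<close> functions vanish on the whole plane spanned by \<open>u\<close> and \<open>w\<close>, on which
  the last one is a binary quadratic form and therefore has a nontrivial zero.
\<close>

lemma common_zero:
  "\<exists>M. \<forall>I qs ls. finite I \<longrightarrow> card I \<ge> M + length ls \<longrightarrow> length qs \<le> r \<longrightarrow> (\<forall>q\<in>set qs. quad q) \<longrightarrow>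
      (\<forall>l\<in>set ls. lin l) \<longrightarrow>
      (\<exists>v :: nat \<Rightarrow> 'k::alg_closed_field. supported I v \<and> (\<exists>i. v i \<noteq> 0) \<and> (\<forall>q\<in>set qs. q v = 0) \<and>
        (\<forall>l\<in>set ls. l v = 0))"
proof (induction r)
  case 0
  show ?case
  proof (intro exI[of _ 1] allI impI, rule common_zero_add_linear[where r = 0 and M = 1])
    fix I :: "nat set" and qs :: "((nat \<Rightarrow> 'k) \<Rightarrow> 'k) list"
    assume "finite I" "1 \<le> card I" "length qs \<le> 0"
    then obtain i where "i \<in> I" "qs = []" by (cases "I = {}") auto
    then show "\<exists>v. supported I v \<and> (\<exists>i. v i \<noteq> 0) \<and> (\<forall>q\<in>set qs. q v = 0)"
      by (intro exI[of _ "unit_vec i"]) (auto simp: supported_def unit_vec_def)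
  qed auto
next
  case (Suc r)
  then obtain M where M: "\<And>I qs ls. finite I \<Longrightarrow> card I \<ge> M + length ls \<Longrightarrow> length qs \<le> r \<Longrightarrow>
      (\<forall>q\<in>set qs. quad q) \<Longrightarrow> (\<forall>l\<in>set ls. lin l) \<Longrightarrow>
      (\<exists>v :: nat \<Rightarrow> 'k. supported I v \<and> (\<exists>i. v i \<noteq> 0) \<and> (\<forall>q\<in>set qs. q v = 0) \<and>
        (\<forall>l\<in>set ls. l v = 0))"
    by blast
  have two_blocks: "\<exists>v :: nat \<Rightarrow> 'k. supported I v \<and> (\<exists>i. v i \<noteq> 0) \<and> (\<forall>q\<in>set qs. q v = 0)"
    if I: "finite I" "card I \<ge> M + (M + r)" and qs: "length qs \<le> Suc r" "\<forall>q\<in>set qs. quad q"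
    for I and qs :: "((nat \<Rightarrow> 'k) \<Rightarrow> 'k) list"
  proof (cases qs)
    case Nil
    then show ?thesis using M[of I "[]" "[]"] I by auto
  next
    case (Cons q qs')
    obtain I1 where I1: "I1 \<subseteq> I" "card I1 = M" "finite I1"
      using I obtain_subset_with_card_n[of M I] by auto
    have card2: "card (I - I1) \<ge> M + r"
      using I I1 by (simp add: card_Diff_subset)
    obtain B where B: "\<And>q. q \<in> set qs \<Longrightarrow> polar q (B q)"
      using qs(2) unfolding quad_def by metis
    obtain u i where u: "supported I1 u" "u i \<noteq> 0" "\<forall>q\<in>set qs'. q u = 0"
      using M[of I1 "[]" qs'] I1 qs Cons by auto
    have "\<exists>w. supported (I - I1) w \<and> (\<exists>i. w i \<noteq> 0) \<and> (\<forall>q\<in>set qs'. q w = 0) \<and>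
        (\<forall>l\<in>set (map (\<lambda>q. B q u) qs'). l w = 0)"
      using I qs Cons card2 B by (intro M) (auto simp: polar_def)
    then obtain w j where w: "supported (I - I1) w" "w j \<noteq> 0" "\<forall>q\<in>set qs'. q w = 0"
        "\<forall>q\<in>set qs'. B q u w = 0" by auto
    obtain s t where st: "s \<noteq> 0 \<or> t \<noteq> 0" "q u * s\<^sup>2 + B q u w * s * t + q w * t\<^sup>2 = 0"
      using binary_quadratic_form_isotropic by blast
    define v where "v = lincomb s u t w"
    have "v i = s * u i" "v j = t * w j"
      using u(1,2) w(1,2) by (auto simp: v_def lincomb_def supported_def)
    then have "\<exists>i. v i \<noteq> 0" using st(1) u(2) w(2) by (metis mult_eq_0_iff)
    moreover have "supported I v"
      using u(1) w(1) I1(1) unfolding v_def lincomb_def supported_def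
      by (metis DiffD1 add.right_neutral mult_zero_right subsetD)
    moreover have "q' v = 0" if "q' \<in> set qs" for q'
    proof -
      have "q' v = s\<^sup>2 * q' u + s * t * B q' u w + t\<^sup>2 * q' w"
        using B[OF that] by (simp add: polar_def v_def)
      then show ?thesis using that Cons u(3) w(3,4) st(2) by (auto simp: algebra_simps)
    qed
    ultimately show ?thesis by blast
  qed
  show ?case
    by (intro exI[of _ "M + (M + r)"] allI impI, rule common_zero_add_linear[where r = "Suc r" and M = "M + (M + r)"])
       (use two_blocks in auto)
qed

section \<open>Isotropic families and the slice rank of a cubic\<close>

text \<open>
  As \<open>w\<close> runs through the space where \<open>ls\<close> vanishes, the tuples of all values \<open>a w\<close>, \<open>b w\<close> form an
  isotropic subspace of a hyperbolic space whose dimension is twice the number of pairs. An isotropic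
  subspace has at most half that dimension, so one equation per pair forces all \<open>a\<close> and \<open>b\<close> to vanish.
  The induction adds one equation
  per pair: \<open>b = 0\<close> if \<open>a\<close> already vanishes on the given space, and otherwise \<open>a = 0\<close>, in which case
  \<open>b\<close> vanishes as well, by polarising the isotropy relation against a vector where \<open>a\<close> is nonzero.
\<close>

lemma isotropic_common_kernel:
  fixes ps :: "(((nat \<Rightarrow> 'k) \<Rightarrow> 'k::field) \<times> ((nat \<Rightarrow> 'k) \<Rightarrow> 'k)) list"
  assumes "\<forall>(a, b)\<in>set ps. lin a \<and> lin b" "\<forall>l\<in>set ls. lin l"
    and "\<And>w. \<forall>l\<in>set ls. l w = 0 \<Longrightarrow> (\<Sum>(a, b)\<leftarrow>ps. a w * b w) = 0"
  shows "\<exists>ls'. length ls' = length ps \<and> (\<forall>l\<in>set ls'. lin l) \<and>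
    (\<forall>w. (\<forall>l\<in>set ls. l w = 0) \<longrightarrow> (\<forall>l\<in>set ls'. l w = 0) \<longrightarrow> (\<forall>(a, b)\<in>set ps. a w = 0 \<and> b w = 0))"
  using assms
proof (induction ps arbitrary: ls)
  case Nil
  then show ?case by auto
next
  case (Cons ab ps)
  obtain a b where ab: "ab = (a, b)" by fastforce
  have lin: "lin a" "lin b" using Cons.prems ab by auto
  show ?case
  proof (cases "\<forall>w. (\<forall>l\<in>set ls. l w = 0) \<longrightarrow> a w = 0")
    case True
    have "\<exists>ls'. length ls' = length ps \<and> (\<forall>l\<in>set ls'. lin l) \<and>
      (\<forall>w. (\<forall>l\<in>set (b # ls). l w = 0) \<longrightarrow> (\<forall>l\<in>set ls'. l w = 0) \<longrightarrow> (\<forall>(a, b)\<in>set ps. a w = 0 \<and> b w = 0))"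
    proof (rule Cons.IH)
      fix w assume "\<forall>l\<in>set (b # ls). l w = 0"
      then show "(\<Sum>(a, b)\<leftarrow>ps. a w * b w) = 0"
        using Cons.prems(3)[of w] ab by simp
    qed (use Cons.prems lin in auto)
    then obtain ls' where ls': "length ls' = length ps" "\<forall>l\<in>set ls'. lin l"
      "\<And>w. \<forall>l\<in>set (b # ls). l w = 0 \<Longrightarrow> \<forall>l\<in>set ls'. l w = 0 \<Longrightarrow> \<forall>(a, b)\<in>set ps. a w = 0 \<and> b w = 0"
      by blast
    show ?thesis
      using ls' lin True ab by (intro exI[of _ "b # ls'"]) auto
  next
    case False
    then obtain w0 where w0: "\<forall>l\<in>set ls. l w0 = 0" "a w0 \<noteq> 0" by blast
    have "\<exists>ls'. length ls' = length ps \<and> (\<forall>l\<in>set ls'. lin l) \<and>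
      (\<forall>w. (\<forall>l\<in>set (a # ls). l w = 0) \<longrightarrow> (\<forall>l\<in>set ls'. l w = 0) \<longrightarrow> (\<forall>(a, b)\<in>set ps. a w = 0 \<and> b w = 0))"
    proof (rule Cons.IH)
      fix w assume "\<forall>l\<in>set (a # ls). l w = 0"
      then show "(\<Sum>(a, b)\<leftarrow>ps. a w * b w) = 0"
        using Cons.prems(3)[of w] ab by simp
    qed (use Cons.prems lin in auto)
    then obtain ls' where ls': "length ls' = length ps" "\<forall>l\<in>set ls'. lin l"
      "\<And>w. \<forall>l\<in>set (a # ls). l w = 0 \<Longrightarrow> \<forall>l\<in>set ls'. l w = 0 \<Longrightarrow> \<forall>(a, b)\<in>set ps. a w = 0 \<and> b w = 0"
      by blast
    have "b w = 0" if w: "\<forall>l\<in>set ls. l w = 0" "a w = 0" "\<forall>l\<in>set ls'. l w = 0" for w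
    proof -
      have ps0: "\<forall>(a, b)\<in>set ps. a w = 0 \<and> b w = 0" using ls'(3)[of w] w by auto
      let ?u = "lincomb 1 w 1 w0"
      have "\<forall>l\<in>set ls. l ?u = 0" using w(1) w0(1) Cons.prems(2) by (auto simp: lin_lincomb)
      then have "(\<Sum>(a, b)\<leftarrow>ab # ps. a ?u * b ?u) = 0" using Cons.prems(3) by blast
      moreover have "(\<Sum>(a, b)\<leftarrow>ps. a ?u * b ?u) = (\<Sum>(a, b)\<leftarrow>ps. a w0 * b w0)"
      proof (intro arg_cong[where f = sum_list] map_cong refl, clarify)
        fix a b assume "(a, b) \<in> set ps"
        then have "lin a" "lin b" "a w = 0" "b w = 0" using ps0 Cons.prems(1) by auto
        then show "a ?u * b ?u = a w0 * b w0" by (simp add: lin_lincomb)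
      qed
      moreover have "(\<Sum>(a, b)\<leftarrow>ab # ps. a w0 * b w0) = 0" using Cons.prems(3) w0(1) by blast
      moreover have "a ?u = a w0" "b ?u = b w + b w0"
        using lin w(2) by (simp_all add: lin_lincomb)
      ultimately have "a w0 * (b w + b w0) + (\<Sum>(a, b)\<leftarrow>ps. a w0 * b w0) =
          a w0 * b w0 + (\<Sum>(a, b)\<leftarrow>ps. a w0 * b w0)"
        by (simp add: ab)
      then have "a w0 * b w = 0" by (simp add: algebra_simps)
      then show ?thesis using w0(2) by simp
    qed
    then show ?thesis
      using ls' lin ab by (intro exI[of _ "a # ls'"]) auto
  qed
qed

text \<open>
  The cubic \<open>\<Sum> \<xi>\<^sub>i\<^sup>2 \<tau>\<^sub>i\<close>, with \<open>\<xi>\<^sub>i\<close> and \<open>\<tau>\<^sub>i\<close> stored in the coordinates \<open>2 i\<close> and \<open>2 i + 1\<close>, does not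
  vanish on any linear space of codimension smaller than the number of its terms. A nontrivial equation can
  be solved for one coordinate \<open>\<xi>\<^sub>i\<close> or \<open>\<tau>\<^sub>i\<close>; setting the other one of this pair to zero
  kills the \<open>i\<close>-th term and leaves the same problem with one term and one equation less. The support
  clause is there for the induction: an equation with zero coefficients on the coordinates in use
  then holds automatically.
\<close>

lemma cubic_slice_rank:
  fixes I :: "nat set" and ls :: "((nat \<Rightarrow> 'k::field) \<Rightarrow> 'k) list"
  assumes "finite I" "length ls < card I" "\<forall>l\<in>set ls. lin l"
  shows "\<exists>w. supported ((\<lambda>i. 2 * i) ` I \<union> (\<lambda>i. 2 * i + 1) ` I) w \<and> (\<forall>l\<in>set ls. l w = 0) \<and>
     (\<Sum>i\<in>I. (w (2 * i))\<^sup>2 * w (2 * i + 1)) \<noteq> 0"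
  using assms
proof (induction "length ls" arbitrary: ls I)
  case 0
  then obtain i where i: "i \<in> I" by (cases "I = {}") auto
  let ?w = "lincomb 1 (unit_vec (2 * i)) 1 (unit_vec (2 * i + 1)) :: nat \<Rightarrow> 'k"
  have "2 * i \<noteq> Suc (2 * j)" "Suc (2 * i) \<noteq> 2 * j" for i j :: nat by presburger+
  then have *: "?w (2 * j) = (if j = i then 1 else 0)" "?w (2 * j + 1) = (if j = i then 1 else 0)" for j
    by (auto simp: lincomb_def unit_vec_def)
  have "(\<Sum>j\<in>I. (?w (2 * j))\<^sup>2 * ?w (2 * j + 1)) = (\<Sum>j\<in>I. if j = i then 1 else 0)"
    unfolding * by (intro sum.cong) auto
  also have "\<dots> = 1" using i 0 by simp
  finally have "(\<Sum>j\<in>I. (?w (2 * j))\<^sup>2 * ?w (2 * j + 1)) \<noteq> 0" by simp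
  moreover have "supported ((\<lambda>i. 2 * i) ` I \<union> (\<lambda>i. 2 * i + 1) ` I) ?w"
    using i by (auto simp: supported_def lincomb_def unit_vec_def split: if_splits)
  ultimately show ?case using 0 by (intro exI[of _ ?w]) auto
next
  case (Suc n)
  then obtain l ls' where ls: "ls = l # ls'" by (cases ls) auto
  have l: "lin l" using Suc.prems ls by auto
  let ?S = "\<lambda>I. (\<lambda>i :: nat. 2 * i) ` I \<union> (\<lambda>i. 2 * i + 1) ` I"
  show ?case
  proof (cases "\<forall>c\<in>?S I. l (unit_vec c) = 0")
    case True
    obtain w where w: "supported (?S I) w" "\<forall>l\<in>set ls'. l w = 0"
      "(\<Sum>i\<in>I. (w (2 * i))\<^sup>2 * w (2 * i + 1)) \<noteq> 0"
      using Suc.hyps(1)[of ls' I] Suc.hyps(2) Suc.prems ls by auto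
    have "l w = 0"
      using lin_expand[OF l _ w(1)] Suc.prems(1) True by simp
    then show ?thesis using w ls by (intro exI[of _ w]) auto
  next
    case False
    then obtain c where c: "c \<in> ?S I" "l (unit_vec c) \<noteq> 0" by auto
    then obtain i where i: "i \<in> I" "c = 2 * i \<or> c = 2 * i + 1" by auto
    define L where "L = (\<lambda>v. lincomb 1 v (- l v / l (unit_vec c)) (unit_vec c))"
    have L: "linmap L" unfolding L_def by (rule linmap_eliminate[OF l])
    have "\<exists>w. supported (?S (I - {i})) w \<and> (\<forall>l\<in>set (map (\<lambda>l v. l (L v)) ls'). l w = 0) \<and>
        (\<Sum>i\<in>I - {i}. (w (2 * i))\<^sup>2 * w (2 * i + 1)) \<noteq> 0"
      using Suc.hyps(2) Suc.prems ls i by (intro Suc.hyps(1)) (auto intro: lin_comp[OF _ L])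
    then obtain w where w: "supported (?S (I - {i})) w" "\<forall>l\<in>set ls'. l (L w) = 0"
        "(\<Sum>i\<in>I - {i}. (w (2 * i))\<^sup>2 * w (2 * i + 1)) \<noteq> 0" by auto
    have Lw: "L w d = (if d = c then w c + (- l w / l (unit_vec c)) else w d)" for d
      by (simp add: L_def lincomb_def unit_vec_def)
    have par: "2 * i \<noteq> Suc (2 * j)" "Suc (2 * i) \<noteq> 2 * j" for i j :: nat by presburger+
    have w0: "w (2 * i) = 0" "w (2 * i + 1) = 0"
      using w(1) par by (auto simp: supported_def)
    have "(\<Sum>i\<in>I. (L w (2 * i))\<^sup>2 * L w (2 * i + 1)) =
        (L w (2 * i))\<^sup>2 * L w (2 * i + 1) + (\<Sum>i\<in>I - {i}. (L w (2 * i))\<^sup>2 * L w (2 * i + 1))"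
      using Suc.prems(1) i(1) by (rule sum.remove)
    also have "(L w (2 * i))\<^sup>2 * L w (2 * i + 1) = 0"
      using i(2) w0 par by (auto simp: Lw)
    also have "(\<Sum>i\<in>I - {i}. (L w (2 * i))\<^sup>2 * L w (2 * i + 1)) =
        (\<Sum>i\<in>I - {i}. (w (2 * i))\<^sup>2 * w (2 * i + 1))"
      using i(2) par by (intro sum.cong) (auto simp: Lw)
    finally have "(\<Sum>i\<in>I. (L w (2 * i))\<^sup>2 * L w (2 * i + 1)) \<noteq> 0" using w(3) by simp
    moreover have "supported (?S I) (L w)"
      using w(1) c(1) unfolding supported_def Lw by auto
    moreover have "l (L w) = 0" using c(2) by (simp add: L_def lin_lincomb[OF l])
    ultimately show ?thesis using w ls by (intro exI[of _ "L w"]) auto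
  qed
qed

section \<open>Forms\<close>

lemma monom_deg_superset:
  assumes "finite S" "Poly_Mapping.keys m \<subseteq> S"
  shows "monom_deg m = (\<Sum>i\<in>S. Poly_Mapping.lookup m i)"
  unfolding monom_deg_def using assms
  by (intro sum.mono_neutral_left) (auto simp: in_keys_iff)

lemma monom_deg_add: "monom_deg (m + m') = monom_deg m + monom_deg m'"
proof -
  let ?S = "Poly_Mapping.keys m \<union> Poly_Mapping.keys m'"
  have "monom_deg (m + m') = (\<Sum>i\<in>?S. Poly_Mapping.lookup (m + m') i)"
    by (rule monom_deg_superset) (auto dest: subsetD[OF keys_add])
  also have "\<dots> = (\<Sum>i\<in>?S. Poly_Mapping.lookup m i) + (\<Sum>i\<in>?S. Poly_Mapping.lookup m' i)"
    by (simp add: lookup_add sum.distrib)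
  also have "\<dots> = monom_deg m + monom_deg m'"
    by (simp add: monom_deg_superset[of ?S])
  finally show ?thesis .
qed

lemma monom_deg_single: "monom_deg (Poly_Mapping.single i c) = c"
  by (simp add: monom_deg_def)

lemma monom_deg_Suc_split:
  assumes "monom_deg m = Suc d"
  obtains i m' where "m = Poly_Mapping.single i 1 + m'" "monom_deg m' = d"
proof -
  obtain i where i: "i \<in> Poly_Mapping.keys m"
    using assms unfolding monom_deg_def by (metis Zero_not_Suc ex_in_conv sum.empty)
  define m' where "m' = m - Poly_Mapping.single i 1"
  have m: "m = Poly_Mapping.single i 1 + m'"
    using i by (intro poly_mapping_eqI)
      (auto simp: m'_def lookup_add lookup_minus lookup_single when_def in_keys_iff)
  then have "monom_deg m' = d"
    using assms by (simp add: monom_deg_add monom_deg_single)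
  with m that show ?thesis by blast
qed

lemma forms_zero: "0 \<in> forms n d"
  by (simp add: forms_def)

lemma forms_add: "f \<in> forms n d \<Longrightarrow> g \<in> forms n d \<Longrightarrow> f + g \<in> forms n d"
  using keys_add[of f g] unfolding forms_def by blast

lemma forms_uminus: "f \<in> forms n d \<Longrightarrow> - f \<in> forms n d"
  for f :: "'k::ab_group_add mpoly"
  by (simp add: forms_def)

lemma forms_diff: "f \<in> forms n d \<Longrightarrow> g \<in> forms n d \<Longrightarrow> f - g \<in> forms n d"
  for f :: "'k::ab_group_add mpoly"
  using forms_add[OF _ forms_uminus, of f n d g] by simp

lemma forms_sum: "(\<And>i. i \<in> I \<Longrightarrow> f i \<in> forms n d) \<Longrightarrow> (\<Sum>i\<in>I. f i) \<in> forms n d"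
  by (induction I rule: infinite_finite_induct) (auto intro: forms_zero forms_add)

lemma forms_mult:
  fixes f g :: "'k::comm_ring_1 mpoly"
  assumes "f \<in> forms n d" "g \<in> forms n e"
  shows "f * g \<in> forms n (d + e)"
  unfolding forms_def
proof (intro CollectI ballI)
  fix m assume "m \<in> Poly_Mapping.keys (f * g)"
  then obtain a b where m: "m = a + b" "a \<in> Poly_Mapping.keys f" "b \<in> Poly_Mapping.keys g"
    using keys_mult[of f g] by auto
  then have "Poly_Mapping.keys a \<subseteq> {..<n}" "monom_deg a = d"
    "Poly_Mapping.keys b \<subseteq> {..<n}" "monom_deg b = e"
    using assms by (auto simp: forms_def)
  then show "Poly_Mapping.keys m \<subseteq> {..<n} \<and> monom_deg m = d + e"
    using keys_add[of a b] m(1) by (auto simp: monom_deg_add)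
qed

lemma forms_const: "const c \<in> forms n 0"
  by (simp add: forms_def const_def monom_deg_def)

lemma forms_const_mult: "f \<in> forms n d \<Longrightarrow> const c * f \<in> forms n d"
  for f :: "'k::comm_ring_1 mpoly"
  using forms_mult[OF forms_const, of f n d c] by simp

lemma forms_square: "f \<in> forms n 1 \<Longrightarrow> f\<^sup>2 \<in> forms n 2"
  for f :: "'k::comm_ring_1 mpoly"
  using forms_mult[of f n 1 f 1] by (simp add: power2_eq_square one_add_one[symmetric] del: one_add_one)

lemma total_deg_forms:
  assumes "f \<in> forms n d" "f \<noteq> 0"
  shows "total_deg f = d"
proof -
  obtain m where "m \<in> Poly_Mapping.keys f"
    using assms(2) by (metis ex_in_conv keys_eq_empty)
  moreover have "\<forall>m\<in>Poly_Mapping.keys f. monom_deg m = d" using assms(1) by (auto simp: forms_def)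
  ultimately have "monom_deg ` Poly_Mapping.keys f = {d}" by (auto simp: image_iff)
  then show ?thesis by (simp add: total_deg_def)
qed

text \<open>
  This includes \<open>f = 0\<close>, which is homogeneous of every degree and has total degree 0.
\<close>

lemma homogeneous_total_deg:
  assumes "homogeneous n f"
  shows "f \<in> forms n (total_deg f)"
  using assms total_deg_forms[of f n] forms_zero
  unfolding homogeneous_def by (cases "f = 0") auto

section \<open>Evaluation\<close>

definition monom_eval :: "(nat \<Rightarrow> 'k) \<Rightarrow> (nat \<Rightarrow>\<^sub>0 nat) \<Rightarrow> 'k::comm_ring_1" where
  "monom_eval v m = (\<Prod>i\<in>Poly_Mapping.keys m. v i ^ Poly_Mapping.lookup m i)"

definition mpoly_eval :: "'k mpoly \<Rightarrow> (nat \<Rightarrow> 'k) \<Rightarrow> 'k::comm_ring_1" where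
  "mpoly_eval f v = (\<Sum>m\<in>Poly_Mapping.keys f. Poly_Mapping.lookup f m * monom_eval v m)"

lemma monom_eval_superset:
  assumes "finite S" "Poly_Mapping.keys m \<subseteq> S"
  shows "monom_eval v m = (\<Prod>i\<in>S. v i ^ Poly_Mapping.lookup m i)"
  unfolding monom_eval_def using assms
  by (intro prod.mono_neutral_left) (auto simp: in_keys_iff)

lemma monom_eval_add: "monom_eval v (m + m') = monom_eval v m * monom_eval v m'"
proof -
  let ?S = "Poly_Mapping.keys m \<union> Poly_Mapping.keys m'"
  have "monom_eval v (m + m') = (\<Prod>i\<in>?S. v i ^ Poly_Mapping.lookup (m + m') i)"
    by (rule monom_eval_superset) (auto dest: subsetD[OF keys_add])
  also have "\<dots> = (\<Prod>i\<in>?S. v i ^ Poly_Mapping.lookup m i) * (\<Prod>i\<in>?S. v i ^ Poly_Mapping.lookup m' i)"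
    by (simp add: lookup_add prod.distrib power_add)
  also have "\<dots> = monom_eval v m * monom_eval v m'"
    by (simp add: monom_eval_superset[of ?S])
  finally show ?thesis .
qed

lemma monom_eval_single: "monom_eval v (Poly_Mapping.single i c) = v i ^ c"
  by (simp add: monom_eval_def)

lemma monom_eval_scale: "monom_eval (\<lambda>i. t * v i) m = t ^ monom_deg m * monom_eval v m"
  by (simp add: monom_eval_def monom_deg_def power_mult_distrib prod.distrib power_sum)

lemma mpoly_eval_zero: "mpoly_eval 0 v = 0"
  by (simp add: mpoly_eval_def)

lemma mpoly_eval_add: "mpoly_eval (f + g) v = mpoly_eval f v + mpoly_eval g v"
  unfolding mpoly_eval_def
  by (rule setsum_keys_plus_distrib) (simp_all add: algebra_simps)

lemma mpoly_eval_sum: "mpoly_eval (\<Sum>i\<in>I. f i) v = (\<Sum>i\<in>I. mpoly_eval (f i) v)"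
  by (induction I rule: infinite_finite_induct) (auto simp: mpoly_eval_zero mpoly_eval_add)

lemma mpoly_eval_sum_list: "mpoly_eval (\<Sum>x\<leftarrow>xs. f x) v = (\<Sum>x\<leftarrow>xs. mpoly_eval (f x) v)"
  by (induction xs) (auto simp: mpoly_eval_zero mpoly_eval_add)

lemma mpoly_eval_single: "mpoly_eval (Poly_Mapping.single m c) v = c * monom_eval v m"
  by (simp add: mpoly_eval_def)

lemma mpoly_sum_monomials:
  "f = (\<Sum>m\<in>Poly_Mapping.keys f. Poly_Mapping.single m (Poly_Mapping.lookup f m))"
proof (rule poly_mapping_eqI)
  fix k
  have "(\<Sum>m\<in>Poly_Mapping.keys f. Poly_Mapping.lookup f m when m = k) =
      (\<Sum>m\<in>Poly_Mapping.keys f. if m = k then Poly_Mapping.lookup f m else 0)"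
    by (simp add: when_def)
  also have "\<dots> = Poly_Mapping.lookup f k" by (simp add: in_keys_iff)
  finally show "Poly_Mapping.lookup f k =
      Poly_Mapping.lookup (\<Sum>m\<in>Poly_Mapping.keys f. Poly_Mapping.single m (Poly_Mapping.lookup f m)) k"
    by (simp add: lookup_sum lookup_single)
qed

lemma mpoly_eval_mult: "mpoly_eval (f * g) v = mpoly_eval f v * mpoly_eval g v"
proof -
  let ?l = Poly_Mapping.lookup and ?s = Poly_Mapping.single
  have "f * g = (\<Sum>m\<in>Poly_Mapping.keys f. ?s m (?l f m)) * (\<Sum>m\<in>Poly_Mapping.keys g. ?s m (?l g m))"
    using mpoly_sum_monomials[of f] mpoly_sum_monomials[of g] by simp
  also have "\<dots> = (\<Sum>m\<in>Poly_Mapping.keys f. \<Sum>m'\<in>Poly_Mapping.keys g. ?s (m + m') (?l f m * ?l g m'))"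
    by (simp add: sum_product mult_single)
  also have "mpoly_eval \<dots> v = (\<Sum>m\<in>Poly_Mapping.keys f. \<Sum>m'\<in>Poly_Mapping.keys g.
      (?l f m * monom_eval v m) * (?l g m' * monom_eval v m'))"
    by (simp add: mpoly_eval_sum mpoly_eval_single monom_eval_add mult_ac)
  also have "\<dots> = mpoly_eval f v * mpoly_eval g v"
    by (simp add: mpoly_eval_def sum_product)
  finally show ?thesis .
qed

lemma mpoly_eval_scale:
  assumes "f \<in> forms n d"
  shows "mpoly_eval f (\<lambda>i. t * v i) = t ^ d * mpoly_eval f v"
  using assms
  by (auto simp: mpoly_eval_def monom_eval_scale forms_def sum_distrib_left mult_ac intro!: sum.cong)

lemma lin_monom_eval:
  assumes "monom_deg m = 1"
  shows "lin (\<lambda>v. monom_eval v m :: 'k::comm_ring_1)"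
proof -
  obtain i m' where m: "m = Poly_Mapping.single i 1 + m'" "monom_deg m' = 0"
    using assms monom_deg_Suc_split[of m 0] by auto
  have "monom_eval v m' = 1" for v :: "nat \<Rightarrow> 'k"
    using m(2) by (auto simp: monom_deg_def monom_eval_def)
  then show ?thesis
    by (simp only: m(1) monom_eval_add monom_eval_single power_one_right mult_1_right lin_coordinate)
qed

lemma lin_mpoly_eval:
  assumes "f \<in> forms n 1"
  shows "lin (mpoly_eval f)"
proof -
  have "lin (\<lambda>v. \<Sum>m\<in>Poly_Mapping.keys f. Poly_Mapping.lookup f m * monom_eval v m)"
    using assms by (intro lin_sum lin_const_mult lin_monom_eval) (auto simp: forms_def)
  then show ?thesis by (simp add: mpoly_eval_def[abs_def])
qed

lemma quad_mpoly_eval: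
  assumes "f \<in> forms n 2"
  shows "quad (mpoly_eval f)"
proof -
  have "quad (\<lambda>v. monom_eval v m :: 'a)" if deg: "monom_deg m = 2" for m
  proof -
    obtain i m' where m: "m = Poly_Mapping.single i 1 + m'" "monom_deg m' = 1"
      using deg monom_deg_Suc_split[of m 1] by (auto simp: numeral_2_eq_2)
    then show ?thesis
      using quad_mult[OF lin_coordinate[of i] lin_monom_eval[OF m(2)]]
      by (simp only: m(1) monom_eval_add monom_eval_single power_one_right)
  qed
  then have "quad (\<lambda>v. \<Sum>m\<in>Poly_Mapping.keys f. Poly_Mapping.lookup f m * monom_eval v m)"
    using assms by (intro quad_sum quad_const_mult) (auto simp: forms_def)
  then show ?thesis by (simp add: mpoly_eval_def[abs_def])
qed

section \<open>Quartics as limits of forms of strength three\<close>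

text \<open>
  Two degenerate cases are absorbed here: a strength decomposition excludes zero factors, so these
  are dropped from the list, and it bounds degrees by the actual degree of \<open>f\<close>, so \<open>f = 0\<close> is
  covered by the empty decomposition.
\<close>

lemma strength_le_sum_of_quadric_products:
  fixes f :: "'k::comm_ring_1 mpoly"
  assumes "f \<in> forms n 4" "f = (\<Sum>(g, h)\<leftarrow>ps. g * h)"
    and ps: "\<forall>(g, h)\<in>set ps. g \<in> forms n 2 \<and> h \<in> forms n 2"
  shows "strength n f \<le> enat (length ps)"
proof (cases "f = 0")
  case True
  then have "strength_decomposition n f []" by (simp add: strength_decomposition_def)
  then have "strength n f \<le> enat (length ([] :: ('k mpoly \<times> 'k mpoly) list))"
    unfolding strength_def by (intro Inf_lower) blast
  then show ?thesis by (metis enat_ord_simps(1) le0 list.size(3) order_trans)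
next
  case False
  then have deg: "total_deg f = 4" using assms(1) total_deg_forms by blast
  define qs where "qs = filter (\<lambda>(g, h). g \<noteq> 0 \<and> h \<noteq> 0) ps"
  have "(\<Sum>(g, h)\<leftarrow>qs. g * h) = (\<Sum>(g, h)\<leftarrow>ps. g * h)"
    unfolding qs_def by (induction ps) auto
  moreover have "homogeneous n g \<and> total_deg g = 2 \<and> homogeneous n h \<and> total_deg h = 2"
    if "(g, h) \<in> set qs" for g h
  proof -
    have "g \<in> forms n 2" "h \<in> forms n 2" "g \<noteq> 0" "h \<noteq> 0" using that ps by (auto simp: qs_def)
    then show ?thesis using total_deg_forms unfolding homogeneous_def by blast
  qed
  ultimately have "strength_decomposition n f qs"
    using assms(2) deg by (auto simp: strength_decomposition_def)
  then have "strength n f \<le> enat (length qs)"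
    unfolding strength_def by (intro Inf_lower) blast
  also have "\<dots> \<le> enat (length ps)" by (simp add: qs_def)
  finally show ?thesis .
qed

text \<open>
  The products \<open>(x\<^sup>2 + t g) (y\<^sup>2 + t f)\<close> and \<open>(u\<^sup>2 - t q) (v\<^sup>2 - t p)\<close> have the first order terms
  \<open>x\<^sup>2 f + y\<^sup>2 g\<close> and \<open>- (u\<^sup>2 p + v\<^sup>2 q)\<close>. Their difference has constant term \<open>x\<^sup>2 y\<^sup>2 - u\<^sup>2 v\<^sup>2\<close>, a difference of
  squares and so a single product \<open>(x y - u v) (x y + u v)\<close>. Subtracting it leaves
  \<open>t (h + t (f g - p q))\<close>; for \<open>t \<noteq> 0\<close> one divides by \<open>t\<close>.
\<close>

lemma limit_of_strength_le_3:
  fixes x y u v f g p q :: "'k::field mpoly"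
  assumes lin: "x \<in> forms n 1" "y \<in> forms n 1" "u \<in> forms n 1" "v \<in> forms n 1"
    and quad: "f \<in> forms n 2" "g \<in> forms n 2" "p \<in> forms n 2" "q \<in> forms n 2"
  shows "limit_of_strength_le n 4 3 (x\<^sup>2 * f + y\<^sup>2 * g + u\<^sup>2 * p + v\<^sup>2 * q)"
proof -
  define h where "h = x\<^sup>2 * f + y\<^sup>2 * g + u\<^sup>2 * p + v\<^sup>2 * q"
  define H where "H = [:h, f * g - p * q:]"
  have prod4: "a * b \<in> forms n 4" if "a \<in> forms n 2" "b \<in> forms n 2" for a b :: "'k mpoly"
    using forms_mult[OF that] by simp
  have prod2: "a * b \<in> forms n 2" if "a \<in> forms n 1" "b \<in> forms n 1" for a b :: "'k mpoly"
    using forms_mult[OF that] by (simp add: numeral_2_eq_2)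
  have h4: "h \<in> forms n 4"
    unfolding h_def using lin quad by (intro forms_add prod4 forms_square)
  have d4: "f * g - p * q \<in> forms n 4"
    using quad by (intro forms_diff prod4)
  have "coeff H i \<in> forms n 4" for i
    using h4 d4 by (auto simp: H_def coeff_pCons forms_zero split: nat.splits)
  moreover have "poly H (const 0) = h" by (simp add: H_def const_def)
  moreover have "strength n (poly H (const t)) \<le> enat 3" if t: "t \<noteq> 0" for t
  proof -
    define T where "T = (const t :: 'k mpoly)"
    define S where "S = (const (1 / t) :: 'k mpoly)"
    have ST: "S * T = 1" using t by (simp add: S_def T_def const_def mult_single)
    \<comment> \<open>\<open>S\<close> is the inverse of the parameter, attached to one factor of each product.\<close>
    define ps where "ps = [(S * (x\<^sup>2 + T * g), y\<^sup>2 + T * f),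
       (- (S * (u\<^sup>2 - T * q)), v\<^sup>2 - T * p), (- (S * (x * y - u * v)), x * y + u * v)]"
    have Hform: "poly H T = h + T * (f * g - p * q)" by (simp add: H_def)
    have "(\<Sum>(a, b)\<leftarrow>ps. a * b) = (S * T) * (h + T * (f * g - p * q))"
      by (simp add: ps_def h_def power2_eq_square algebra_simps)
    then have "poly H T = (\<Sum>(a, b)\<leftarrow>ps. a * b)" by (simp add: Hform ST)
    moreover have "poly H T \<in> forms n 4"
      unfolding Hform unfolding T_def by (intro forms_add forms_const_mult h4 d4)
    moreover have "\<forall>(a, b)\<in>set ps. a \<in> forms n 2 \<and> b \<in> forms n 2"
      using lin quad unfolding ps_def S_def T_def
      by (auto intro!: forms_add forms_diff forms_uminus forms_const_mult forms_square prod2)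
    ultimately have "strength n (poly H T) \<le> enat (length ps)"
      by (intro strength_le_sum_of_quadric_products)
    then show ?thesis by (simp add: T_def ps_def eval_nat_numeral)
  qed
  ultimately show ?thesis unfolding limit_of_strength_le_def h_def[symmetric] by blast
qed

section \<open>A quartic of strength four\<close>

definition mvar :: "nat \<Rightarrow> 'k::comm_ring_1 mpoly" where
  "mvar i = Poly_Mapping.single (Poly_Mapping.single i 1) 1"

text \<open>
  The variables are grouped as \<open>x\<^sub>0, \<dots>, x\<^sub>3\<close>, then \<open>y\<^sub>0, \<dots>, y\<^bsub>M-1\<^esub>\<close>, then \<open>z\<^bsub>k,i\<^esub>\<close> with \<open>k < M\<close> and \<open>i < 4\<close> at
  index \<open>4 + M + 4 k + i\<close>. The quadric is \<open>\<Sum> y\<^sub>k z\<^bsub>k,i\<^esub>\<close>: at every point with \<open>y \<noteq> 0\<close> and \<open>z = 0\<close> the four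
  quadrics vanish and their differentials are linearly independent.
\<close>

definition block_quadric :: "nat \<Rightarrow> nat \<Rightarrow> 'k::comm_ring_1 mpoly" where
  "block_quadric M i = (\<Sum>k<M. mvar (4 + k) * mvar (4 + M + 4 * k + i))"

definition strength4_quartic :: "nat \<Rightarrow> 'k::comm_ring_1 mpoly" where
  "strength4_quartic M = (mvar 0)\<^sup>2 * block_quadric M 0 + (mvar 1)\<^sup>2 * block_quadric M 1 +
     (mvar 2)\<^sup>2 * block_quadric M 2 + (mvar 3)\<^sup>2 * block_quadric M 3"

lemma mvar_forms: "i < n \<Longrightarrow> mvar i \<in> forms n 1"
  by (simp add: mvar_def forms_def monom_deg_single)

lemma block_quadric_forms:
  assumes "n \<ge> 4 + 5 * M" "i < 4"
  shows "block_quadric M i \<in> forms n 2"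
  unfolding block_quadric_def
proof (rule forms_sum)
  fix k assume "k \<in> {..<M}"
  then have "mvar (4 + k) * mvar (4 + M + 4 * k + i) \<in> forms n (1 + 1)"
    using assms by (intro forms_mult mvar_forms) auto
  then show "mvar (4 + k) * mvar (4 + M + 4 * k + i) \<in> forms n 2"
    by (simp add: numeral_2_eq_2)
qed

lemma mpoly_eval_mvar: "mpoly_eval (mvar i) v = v i"
  by (simp add: mvar_def mpoly_eval_single monom_eval_single)

lemma mpoly_eval_strength4_quartic:
  "mpoly_eval (strength4_quartic M) v =
     (\<Sum>i<4. (v i)\<^sup>2 * (\<Sum>k<M. v (4 + k) * v (4 + M + 4 * k + i)))"
  by (simp add: strength4_quartic_def block_quadric_def mpoly_eval_add mpoly_eval_mult mpoly_eval_sum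
      mpoly_eval_mvar power2_eq_square eval_nat_numeral ac_simps)

text \<open>
  An eight-dimensional space of directions at a point with \<open>x = z = 0\<close> and \<open>y\<^bsub>k0\<^esub> = 1 / c\<close>.
  It sends \<open>w\<close> to the vector with \<open>x\<^sub>i = w (2 i)\<close> and \<open>z\<^bsub>k0,i\<^esub> = c w (2 i + 1)\<close>; the scaling makes the
  differential of the \<open>i\<close>-th block quadric in this direction equal to \<open>w (2 i + 1)\<close>.
\<close>

definition slice_map :: "nat \<Rightarrow> nat \<Rightarrow> 'k \<Rightarrow> (nat \<Rightarrow> 'k) \<Rightarrow> nat \<Rightarrow> 'k::comm_ring_1" where
  "slice_map M k0 c w = (\<lambda>j. if j < 4 then w (2 * j)
     else if 4 + M + 4 * k0 \<le> j \<and> j < 4 + M + 4 * k0 + 4 then c * w (2 * (j - (4 + M + 4 * k0)) + 1)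
     else 0)"

lemma linmap_slice_map: "linmap (slice_map M k0 c)"
  by (auto simp: linmap_def slice_map_def lincomb_def fun_eq_iff algebra_simps)

lemma quartic_along_slice:
  fixes P :: "nat \<Rightarrow> 'k::field"
  assumes P: "supported {4..<4 + M} P" and k0: "k0 < M" "P (4 + k0) \<noteq> 0"
  shows "mpoly_eval (strength4_quartic M) (lincomb 1 P t (slice_map M k0 (1 / P (4 + k0)) w)) =
    t ^ 3 * (\<Sum>i<4. (w (2 * i))\<^sup>2 * w (2 * i + 1))"
proof -
  define v where "v = lincomb 1 P t (slice_map M k0 (1 / P (4 + k0)) w)"
  have P0: "P j = 0" if "j < 4 \<or> j \<ge> 4 + M" for j
    using P that by (force simp: supported_def)
  have vx: "v i = t * w (2 * i)" if "i < 4" for i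
    using that by (simp add: v_def lincomb_def slice_map_def P0)
  have vy: "v (4 + k) = P (4 + k)" if "k < M" for k
    using that by (simp add: v_def lincomb_def slice_map_def)
  have vz: "v (4 + M + 4 * k + i) = (if k = k0 then t * w (2 * i + 1) / P (4 + k0) else 0)"
    if "i < 4" for k i
  proof (cases "k = k0")
    case True
    then show ?thesis using that P0[of "4 + M + 4 * k + i"] by (simp add: v_def lincomb_def slice_map_def)
  next
    case False
    then have "\<not> (4 + M + 4 * k0 \<le> 4 + M + 4 * k + i \<and> 4 + M + 4 * k + i < 4 + M + 4 * k0 + 4)"
      using that by arith
    then have "slice_map M k0 (1 / P (4 + k0)) w (4 + M + 4 * k + i) = 0"
      by (auto simp: slice_map_def)
    then show ?thesis using False P0[of "4 + M + 4 * k + i"] by (simp add: v_def lincomb_def)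
  qed
  have "(\<Sum>k<M. v (4 + k) * v (4 + M + 4 * k + i)) = t * w (2 * i + 1)" if "i < 4" for i
  proof -
    have "(\<Sum>k<M. v (4 + k) * v (4 + M + 4 * k + i)) =
        (\<Sum>k<M. if k = k0 then P (4 + k0) * (t * w (2 * i + 1) / P (4 + k0)) else 0)"
      by (intro sum.cong refl) (simp add: vy vz[OF that])
    also have "\<dots> = t * w (2 * i + 1)" using k0 by simp
    finally show ?thesis .
  qed
  then have "(v i)\<^sup>2 * (\<Sum>k<M. v (4 + k) * v (4 + M + 4 * k + i)) = t ^ 3 * ((w (2 * i))\<^sup>2 * w (2 * i + 1))"
    if "i < 4" for i
    using that by (simp add: vx power_mult_distrib power2_eq_square power3_eq_cube)
  then show ?thesis
    unfolding v_def[symmetric] mpoly_eval_strength4_quartic sum_distrib_left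
    by (intro sum.cong) auto
qed

text \<open>
  Comparison of the coefficients of \<open>t\<^sup>2\<close> and \<open>t\<^sup>3\<close>, where \<open>a\<close>, \<open>b\<close> are the first and \<open>a'\<close>, \<open>b'\<close> the second
  order terms of the factors.
\<close>

lemma product_expansion_coefficients:
  fixes ps :: "('k::alg_closed_field \<times> 'k \<times> 'k \<times> 'k) list"
  assumes "\<And>t. (\<Sum>(a, a', b, b')\<leftarrow>ps. (t * a + t\<^sup>2 * a') * (t * b + t\<^sup>2 * b')) = t ^ 3 * c"
  shows "(\<Sum>(a, a', b, b')\<leftarrow>ps. a * b) = 0" "(\<Sum>(a, a', b, b')\<leftarrow>ps. a * b' + a' * b) = c"
proof -
  define X where "X = (\<Sum>(a, a', b, b')\<leftarrow>ps. a * b)"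
  define Y where "Y = (\<Sum>(a, a', b, b')\<leftarrow>ps. a * b' + a' * b)"
  define Z where "Z = (\<Sum>(a, a', b, b')\<leftarrow>ps. a' * b')"
  have expand: "(\<Sum>(a, a', b, b')\<leftarrow>qs. (t * a + t\<^sup>2 * a') * (t * b + t\<^sup>2 * b')) =
      t\<^sup>2 * (\<Sum>(a, a', b, b')\<leftarrow>qs. a * b) + t ^ 3 * (\<Sum>(a, a', b, b')\<leftarrow>qs. a * b' + a' * b) +
      t ^ 4 * (\<Sum>(a, a', b, b')\<leftarrow>qs. a' * b')" for t and qs :: "('k \<times> 'k \<times> 'k \<times> 'k) list"
    by (induction qs) (auto simp: algebra_simps eval_nat_numeral)
  have "poly [:0, 0, X, Y - c, Z:] t = 0" for t
    using assms[of t] unfolding expand X_def[symmetric] Y_def[symmetric] Z_def[symmetric]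
    by (simp add: algebra_simps eval_nat_numeral)
  then have "[:0, 0, X, Y - c, Z:] = 0" by (rule poly_zero_if_vanishing)
  then show "X = 0" "Y = c" by simp_all
qed

text \<open>
  The heart of the lower bound. The space \<open>K\<close> is where the linear factors vanish; on it only the
  products of quadrics remain. These are expanded around a point \<open>P\<close> with \<open>x = z = 0\<close> and \<open>y \<noteq> 0\<close> at which all
  factors that occur as linear or quadratic functions vanish. Order two says that the differentials at \<open>P\<close> are
  isotropic on \<open>K\<close>, so together with \<open>K\<close> at most three linear equations make all of them vanish.
  Order three then says that the cubic \<open>\<Sum> \<xi>\<^sub>i\<^sup>2 \<tau>\<^sub>i\<close> with four terms vanishes on a space of codimension
  at most three, which is impossible. All directions come from the eight-dimensional \<open>slice_map\<close>, so
  that \<open>\<xi>\<^sub>i\<close> and \<open>\<tau>\<^sub>i\<close> are coordinates.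
\<close>

lemma no_short_presentation:
  "\<exists>M. \<forall>ls qs. (\<forall>(l, g)\<in>set ls. lin l) \<longrightarrow> (\<forall>(a, b)\<in>set qs. quad a \<and> quad b) \<longrightarrow>
     length ls + length qs \<le> 3 \<longrightarrow>
     \<not> (\<forall>v :: nat \<Rightarrow> 'k::alg_closed_field. mpoly_eval (strength4_quartic M) v =
          (\<Sum>(l, g)\<leftarrow>ls. l v * g v) + (\<Sum>(a, b)\<leftarrow>qs. a v * b v))"
proof -
  obtain M0 where M0: "\<And>I qs ls. finite I \<Longrightarrow> card I \<ge> M0 + length ls \<Longrightarrow> length qs \<le> 6 \<Longrightarrow>
      (\<forall>q\<in>set qs. quad q) \<Longrightarrow> (\<forall>l\<in>set ls. lin l) \<Longrightarrow>
      (\<exists>v :: nat \<Rightarrow> 'k. supported I v \<and> (\<exists>i. v i \<noteq> 0) \<and> (\<forall>q\<in>set qs. q v = 0) \<and>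
        (\<forall>l\<in>set ls. l v = 0))"
    using common_zero[of 6, where 'k = 'k] by blast
  \<comment> \<open>Three pairs of quadrics give six quadratic equations, and there are at most three linear ones.\<close>
  define M where "M = M0 + 3"
  have False if ls: "\<forall>(l, g)\<in>set ls. lin l" and qs: "\<forall>(a, b)\<in>set qs. quad a \<and> quad b"
    and len: "length ls + length qs \<le> 3"
    and eq: "\<And>v. mpoly_eval (strength4_quartic M) v =
          (\<Sum>(l, g)\<leftarrow>ls. l v * g v) + (\<Sum>(a, b)\<leftarrow>qs. a v * b v)"
    for ls qs :: "(((nat \<Rightarrow> 'k) \<Rightarrow> 'k) \<times> ((nat \<Rightarrow> 'k) \<Rightarrow> 'k)) list"
  proof -
    have "\<exists>v. supported {4..<4 + M} v \<and> (\<exists>i. v i \<noteq> 0) \<and> (\<forall>q\<in>set (map fst qs @ map snd qs). q v = 0) \<and>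
        (\<forall>l\<in>set (map fst ls). l v = 0)"
      using ls qs len by (intro M0) (auto simp: M_def)
    then obtain P i0 where P: "supported {4..<4 + M} P" "P i0 \<noteq> 0"
      and zeros: "\<forall>q\<in>set (map fst qs @ map snd qs). q P = 0" "\<forall>l\<in>set (map fst ls). l P = 0"
      by blast
    have P_qs: "a P = 0" "b P = 0" if "(a, b) \<in> set qs" for a b
      using that zeros(1) by force+
    have P_ls: "l P = 0" if "(l, g) \<in> set ls" for l g
      using that zeros(2) by force
    from P have "i0 \<in> {4..<4 + M}" by (auto simp: supported_def)
    then obtain k0 where k0: "k0 < M" "i0 = 4 + k0"
      by (intro that[of "i0 - 4"]) auto
    define L where "L = slice_map M k0 (1 / P (4 + k0))"
    have L: "linmap L" unfolding L_def by (rule linmap_slice_map)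
    define C where "C = (\<lambda>w :: nat \<Rightarrow> 'k. \<Sum>i<4. (w (2 * i))\<^sup>2 * w (2 * i + 1))"
    define K where "K = map (\<lambda>(l, g) w. l (L w)) ls"
    have linK: "\<forall>l\<in>set K. lin l"
      using ls L by (auto simp: K_def intro: lin_comp)
    define B where "B = (\<lambda>q :: (nat \<Rightarrow> 'k) \<Rightarrow> 'k. SOME B. polar q B)"
    have B: "polar q (B q)" if "quad q" for q
      using that unfolding quad_def B_def by (rule someI_ex)
    have expand: "q (lincomb 1 P t (L w)) = t * B q P (L w) + t\<^sup>2 * q (L w)"
      if "quad q" "q P = 0" for q t w
      using B[OF that(1)] that(2) by (simp add: polar_def)
    have orders: "(\<Sum>(a, b)\<leftarrow>qs. B a P (L w) * B b P (L w)) = 0"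
        "(\<Sum>(a, b)\<leftarrow>qs. B a P (L w) * b (L w) + a (L w) * B b P (L w)) = C w"
      if w: "\<forall>l\<in>set K. l w = 0" for w
    proof -
      let ?rs = "map (\<lambda>(a, b). (B a P (L w), a (L w), B b P (L w), b (L w))) qs"
      have "(\<Sum>(a, a', b, b')\<leftarrow>?rs. (t * a + t\<^sup>2 * a') * (t * b + t\<^sup>2 * b')) = t ^ 3 * C w" for t
      proof -
        let ?v = "lincomb 1 P t (L w)"
        have "l ?v = 0" if "(l, g) \<in> set ls" for l g
        proof -
          have "lin l" "l P = 0" "l (L w) = 0" using that ls P_ls w by (auto simp: K_def)
          then show ?thesis by (simp add: lin_lincomb)
        qed
        then have "(\<Sum>(l, g)\<leftarrow>ls. l ?v * g ?v) = (\<Sum>(l, g)\<leftarrow>ls. 0)"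
          by (intro arg_cong[where f = sum_list] map_cong) auto
        then have "t ^ 3 * C w = (\<Sum>(a, b)\<leftarrow>qs. a ?v * b ?v)"
          using eq[of ?v] quartic_along_slice[OF P(1) k0(1), of t w] P(2) k0(2)
          by (simp add: L_def C_def case_prod_unfold)
        also have "\<dots> = (\<Sum>(a, a', b, b')\<leftarrow>?rs. (t * a + t\<^sup>2 * a') * (t * b + t\<^sup>2 * b'))"
          unfolding map_map
        proof (intro arg_cong[where f = sum_list] map_cong refl, clarify)
          fix a b assume "(a, b) \<in> set qs"
          then have "quad a" "quad b" "a P = 0" "b P = 0" using qs P_qs by auto
          then show "a ?v * b ?v = ((\<lambda>(a, a', b, b'). (t * a + t\<^sup>2 * a') * (t * b + t\<^sup>2 * b')) \<circ>
              (\<lambda>(a, b). (B a P (L w), a (L w), B b P (L w), b (L w)))) (a, b)"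
            by (simp add: expand)
        qed
        finally show ?thesis by simp
      qed
      from product_expansion_coefficients[OF this]
      show "(\<Sum>(a, b)\<leftarrow>qs. B a P (L w) * B b P (L w)) = 0"
        "(\<Sum>(a, b)\<leftarrow>qs. B a P (L w) * b (L w) + a (L w) * B b P (L w)) = C w"
        by (simp_all add: o_def case_prod_unfold)
    qed
    define ps where "ps = map (\<lambda>(a, b). (\<lambda>w. B a P (L w), \<lambda>w. B b P (L w))) qs"
    have "\<exists>K'. length K' = length ps \<and> (\<forall>l\<in>set K'. lin l) \<and>
      (\<forall>w. (\<forall>l\<in>set K. l w = 0) \<longrightarrow> (\<forall>l\<in>set K'. l w = 0) \<longrightarrow> (\<forall>(a, b)\<in>set ps. a w = 0 \<and> b w = 0))"
    proof (rule isotropic_common_kernel[OF _ linK])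
      show "\<forall>(a, b)\<in>set ps. lin a \<and> lin b"
        using B qs by (auto simp: ps_def polar_def intro!: lin_comp[OF _ L])
      show "(\<Sum>(a, b)\<leftarrow>ps. a w * b w) = 0" if "\<forall>l\<in>set K. l w = 0" for w
        using orders(1)[OF that] by (simp add: ps_def o_def case_prod_unfold)
    qed
    then obtain K' where K': "length K' = length ps" "\<forall>l\<in>set K'. lin l"
      "\<And>w. \<forall>l\<in>set K. l w = 0 \<Longrightarrow> \<forall>l\<in>set K'. l w = 0 \<Longrightarrow> \<forall>(a, b)\<in>set ps. a w = 0 \<and> b w = 0"
      by blast
    have "length (K @ K') < card {..<4 :: nat}"
      using len K'(1) by (simp add: K_def ps_def)
    then obtain w where w: "\<forall>l\<in>set (K @ K'). l w = 0" "C w \<noteq> 0"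
      using cubic_slice_rank[of "{..<4}" "K @ K'"] linK K'(2) unfolding C_def by auto
    have "\<forall>(a, b)\<in>set ps. a w = 0 \<and> b w = 0" using K'(3)[of w] w(1) by auto
    then have "(\<Sum>(a, b)\<leftarrow>qs. B a P (L w) * b (L w) + a (L w) * B b P (L w)) = (\<Sum>(a, b)\<leftarrow>qs. 0)"
      by (intro arg_cong[where f = sum_list] map_cong) (auto simp: ps_def)
    then show False using orders(2)[of w] w by (auto simp: case_prod_unfold)
  qed
  then show ?thesis by blast
qed

text \<open>
  A strength decomposition may contain products whose degree differs from that of \<open>f\<close> and which cancel among
  themselves. Along the line through \<open>v\<close> a product of degree \<open>e\<close> scales like \<open>t ^ e\<close>, so comparing the
  coefficients of \<open>t ^ d\<close> discards them.
\<close>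

lemma degree_component_of_products:
  fixes f :: "'k::alg_closed_field mpoly"
  assumes f: "f \<in> forms n d" "f = (\<Sum>(g, h)\<leftarrow>ps. g * h)"
    and hom: "\<forall>(g, h)\<in>set ps. homogeneous n g \<and> homogeneous n h"
  shows "mpoly_eval f v =
    (\<Sum>(g, h)\<leftarrow>filter (\<lambda>(g, h). total_deg g + total_deg h = d) ps. mpoly_eval g v * mpoly_eval h v)"
proof -
  define p where "p = (\<lambda>qs. \<Sum>(g, h)\<leftarrow>qs.
     Polynomial.monom (mpoly_eval g v * mpoly_eval h v) (total_deg g + total_deg h))"
  have pt: "poly (p qs) t = mpoly_eval (\<Sum>(g, h)\<leftarrow>qs. g * h) (\<lambda>i. t * v i)"
    if "set qs \<subseteq> set ps" for qs t
    using that
  proof (induction qs)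
    case Nil
    then show ?case by (simp add: p_def mpoly_eval_zero)
  next
    case (Cons gh qs)
    obtain g h where gh: "gh = (g, h)" by fastforce
    have "g \<in> forms n (total_deg g)" "h \<in> forms n (total_deg h)"
      using Cons.prems hom gh by (auto intro: homogeneous_total_deg)
    then have "mpoly_eval (g * h) (\<lambda>i. t * v i) =
        poly (Polynomial.monom (mpoly_eval g v * mpoly_eval h v) (total_deg g + total_deg h)) t"
      by (simp add: mpoly_eval_mult mpoly_eval_scale poly_monom power_add)
    then show ?case using Cons gh by (simp add: p_def mpoly_eval_add)
  qed
  have "poly (p ps - Polynomial.monom (mpoly_eval f v) d) t = 0" for t
    using pt[of ps t] f by (simp add: poly_monom mpoly_eval_scale)
  then have "p ps - Polynomial.monom (mpoly_eval f v) d = 0" by (rule poly_zero_if_vanishing)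
  then have "mpoly_eval f v = coeff (p ps) d" by simp
  also have "coeff (p qs) d = (\<Sum>(g, h)\<leftarrow>filter (\<lambda>(g, h). total_deg g + total_deg h = d) qs.
      mpoly_eval g v * mpoly_eval h v)" for qs
    unfolding p_def by (induction qs) auto
  finally show ?thesis .
qed

lemma strength4_quartic_forms:
  assumes "n \<ge> 4 + 5 * M"
  shows "strength4_quartic M \<in> forms n 4"
proof -
  have summand: "(mvar i)\<^sup>2 * block_quadric M i \<in> forms n 4" if "i < 4" for i
    using forms_mult[OF forms_square[OF mvar_forms] block_quadric_forms, of i n M i] assms that by simp
  show ?thesis unfolding strength4_quartic_def by (intro forms_add summand) simp_all
qed

text \<open>
  After passing to the component of degree four, every product has either a linear factor or two
  quadratic ones.
\<close>

lemma strength4_quartic_lower_bound: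
  "\<exists>M. \<forall>n\<ge>4 + 5 * M. \<forall>ps.
     strength_decomposition n (strength4_quartic M :: 'k::alg_closed_field mpoly) ps \<longrightarrow> length ps > 3"
proof -
  obtain M where M: "\<And>ls qs. (\<forall>(l, g)\<in>set ls. lin l) \<Longrightarrow> (\<forall>(a, b)\<in>set qs. quad a \<and> quad b) \<Longrightarrow>
     length ls + length qs \<le> 3 \<Longrightarrow>
     \<not> (\<forall>v :: nat \<Rightarrow> 'k. mpoly_eval (strength4_quartic M) v =
          (\<Sum>(l, g)\<leftarrow>ls. l v * g v) + (\<Sum>(a, b)\<leftarrow>qs. a v * b v))"
    using no_short_presentation[where 'k = 'k] by blast
  have "length ps > 3" if n: "n \<ge> 4 + 5 * M"
    and ps: "strength_decomposition n (strength4_quartic M :: 'k mpoly) ps" for n ps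
  proof (rule ccontr)
    assume short: "\<not> length ps > 3"
    let ?f = "strength4_quartic M :: 'k mpoly"
    have f4: "?f \<in> forms n 4" by (rule strength4_quartic_forms[OF n])
    then have deg4: "total_deg ?f \<le> 4"
      using total_deg_forms[OF f4] by (cases "?f = 0") (auto simp: total_deg_def)
    have hom: "\<forall>(g, h)\<in>set ps. homogeneous n g \<and> homogeneous n h \<and> total_deg g \<ge> 1 \<and> total_deg h \<ge> 1"
      and sum: "?f = (\<Sum>(g, h)\<leftarrow>ps. g * h)"
      using ps by (auto simp: strength_decomposition_def)
    define rs where "rs = filter (\<lambda>(g, h). total_deg g + total_deg h = 4) ps"
    have eq: "mpoly_eval ?f v = (\<Sum>(g, h)\<leftarrow>rs. mpoly_eval g v * mpoly_eval h v)" for v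
      unfolding rs_def using f4 sum hom by (intro degree_component_of_products) auto
    define ls where "ls = concat (map (\<lambda>(g, h). if total_deg g = 1 then [(mpoly_eval g, mpoly_eval h)]
       else if total_deg h = 1 then [(mpoly_eval h, mpoly_eval g)] else []) rs)"
    define qs where "qs = concat (map (\<lambda>(g, h). if total_deg g = 1 \<or> total_deg h = 1 then []
       else [(mpoly_eval g, mpoly_eval h)]) rs)"
    have forms: "g \<in> forms n (total_deg g)" "h \<in> forms n (total_deg h)" if "(g, h) \<in> set rs" for g h
      using that hom by (auto simp: rs_def intro: homogeneous_total_deg)
    have "\<forall>(l, g)\<in>set ls. lin l"
      using forms by (fastforce simp: ls_def split: if_splits intro: lin_mpoly_eval)
    moreover have "\<forall>(a, b)\<in>set qs. quad a \<and> quad b"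
    proof -
      have "quad (mpoly_eval g) \<and> quad (mpoly_eval h)"
        if gh: "(g, h) \<in> set rs" "total_deg g \<noteq> 1" "total_deg h \<noteq> 1" for g h
      proof -
        have "total_deg g \<ge> 1" "total_deg h \<ge> 1" "total_deg g + total_deg h = 4"
          using gh(1) hom by (auto simp: rs_def)
        then have "total_deg g = 2" "total_deg h = 2" using gh by auto
        then show ?thesis using forms[OF gh(1)] by (auto intro: quad_mpoly_eval)
      qed
      then show ?thesis by (auto simp: qs_def split: if_splits)
    qed
    moreover have "length ls + length qs = length rs"
      unfolding ls_def qs_def by (induction rs) auto
    then have "length ls + length qs \<le> 3"
      using short by (simp add: rs_def) (meson le_trans length_filter_le not_less)
    moreover have "(\<Sum>(g, h)\<leftarrow>rs. mpoly_eval g v * mpoly_eval h v) =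
       (\<Sum>(l, g)\<leftarrow>ls. l v * g v) + (\<Sum>(a, b)\<leftarrow>qs. a v * b v)" for v
      unfolding ls_def qs_def by (induction rs) (auto simp: algebra_simps)
    ultimately show False using M[of ls qs] eq by auto
  qed
  then show ?thesis by blast
qed

theorem theorem1p3:
  shows "(\<forall>n\<ge>1. \<forall>x\<in>forms n 1. \<forall>y\<in>forms n 1. \<forall>u\<in>forms n 1. \<forall>v\<in>forms n 1.
            \<forall>f\<in>forms n 2. \<forall>g\<in>forms n 2. \<forall>p\<in>forms n 2. \<forall>q\<in>forms n 2.
              limit_of_strength_le n 4 3
                (x^2 * f + y^2 * g + u^2 * p + v^2 * q :: 'k::alg_closed_field mpoly))
       \<and> (\<exists>N. \<forall>n\<ge>N. \<exists>x\<in>forms n 1. \<exists>y\<in>forms n 1. \<exists>u\<in>forms n 1. \<exists>v\<in>forms n 1.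
            \<exists>f\<in>forms n 2. \<exists>g\<in>forms n 2. \<exists>p\<in>forms n 2. \<exists>q\<in>forms n 2.
              strength n (x^2 * f + y^2 * g + u^2 * p + v^2 * q :: 'k mpoly) = 4)"
proof
  show "\<forall>n\<ge>1. \<forall>x\<in>forms n 1. \<forall>y\<in>forms n 1. \<forall>u\<in>forms n 1. \<forall>v\<in>forms n 1.
            \<forall>f\<in>forms n 2. \<forall>g\<in>forms n 2. \<forall>p\<in>forms n 2. \<forall>q\<in>forms n 2.
              limit_of_strength_le n 4 3
                (x^2 * f + y^2 * g + u^2 * p + v^2 * q :: 'k mpoly)"
    by (intro allI impI ballI limit_of_strength_le_3)
next
  obtain M where M: "\<And>n ps. n \<ge> 4 + 5 * M \<Longrightarrow>
      strength_decomposition n (strength4_quartic M :: 'k mpoly) ps \<Longrightarrow> length ps > 3"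
    using strength4_quartic_lower_bound[where 'k = 'k] by blast
  have exact: "strength n (strength4_quartic M :: 'k mpoly) = 4" if n: "n \<ge> 4 + 5 * M" for n
  proof (rule antisym)
    let ?ps = "map (\<lambda>i. ((mvar i)\<^sup>2, block_quadric M i)) [0, 1, 2, 3] :: ('k mpoly \<times> 'k mpoly) list"
    have "strength n (strength4_quartic M :: 'k mpoly) \<le> enat (length ?ps)"
    proof (rule strength_le_sum_of_quadric_products)
      show "strength4_quartic M \<in> forms n 4" by (rule strength4_quartic_forms[OF n])
      show "strength4_quartic M = (\<Sum>(g, h)\<leftarrow>?ps. g * h)"
        by (simp add: strength4_quartic_def add_ac)
      show "\<forall>(g, h)\<in>set ?ps. g \<in> forms n 2 \<and> h \<in> forms n 2"
        using n by (auto intro!: forms_square mvar_forms block_quadric_forms)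
    qed
    then show "strength n (strength4_quartic M :: 'k mpoly) \<le> 4"
      by (simp add: numeral_eq_enat eval_nat_numeral)
    show "4 \<le> strength n (strength4_quartic M :: 'k mpoly)"
      unfolding strength_def
    proof (rule Inf_greatest, clarify)
      fix ps assume "strength_decomposition n (strength4_quartic M :: 'k mpoly) ps"
      then have "4 \<le> length ps" using M[OF n] by fastforce
      then show "4 \<le> enat (length ps)" by (simp add: numeral_eq_enat)
    qed
  qed
  have "\<exists>x\<in>forms n 1. \<exists>y\<in>forms n 1. \<exists>u\<in>forms n 1. \<exists>v\<in>forms n 1.
      \<exists>f\<in>forms n 2. \<exists>g\<in>forms n 2. \<exists>p\<in>forms n 2. \<exists>q\<in>forms n 2.
        strength n (x^2 * f + y^2 * g + u^2 * p + v^2 * q :: 'k mpoly) = 4"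
    if n: "n \<ge> 4 + 5 * M" for n
    by (rule bexI[of _ "mvar 0"], rule bexI[of _ "mvar 1"], rule bexI[of _ "mvar 2"],
        rule bexI[of _ "mvar 3"], rule bexI[of _ "block_quadric M 0"],
        rule bexI[of _ "block_quadric M 1"], rule bexI[of _ "block_quadric M 2"],
        rule bexI[of _ "block_quadric M 3"])
       (use n exact[OF n, unfolded strength4_quartic_def] in
          \<open>simp_all add: mvar_forms block_quadric_forms del: One_nat_def\<close>)
  then show "\<exists>N. \<forall>n\<ge>N. \<exists>x\<in>forms n 1. \<exists>y\<in>forms n 1. \<exists>u\<in>forms n 1. \<exists>v\<in>forms n 1.
            \<exists>f\<in>forms n 2. \<exists>g\<in>forms n 2. \<exists>p\<in>forms n 2. \<exists>q\<in>forms n 2.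
              strength n (x^2 * f + y^2 * g + u^2 * p + v^2 * q :: 'k mpoly) = 4"
    by blast
qed

end
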